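(* Let $X$ be a $T_2$ space of countable closed pseudocharacter, i.e. $\psi_c(X)\le\omega$, and assume that the closure of every countable strongly discrete subset of $X$ is countably compact. Then $X$ is countably compact, $T_3$, and first countable.
   Context: $T_2$ means Hausdorff; $T_3$ means regular and $T_1$. $\tau(X)$ denotes the family of all open sets of $X$. For a point $p$ of a $T_2$ space $X$, the closed pseudocharacter $\psi_c(p,X)$ is the least cardinality of a non-empty family $\mathcal{U}\subset\tau(X)$ with $\{p\}=\bigcap_{U\in\mathcal{U}}U=\bigcap_{U\in\mathcal{U}}\overline{U}$, and $\psi_c(X)=\sup\{\psi_c(p,X):p\in X\}$. A subset $Y\subset X$ is strongly discrete (SD) if there is a map $u:Y\to\tau(X)$ with $y\in u(y)$ for all $y\in Y$ and $u(y)\cap u(z)=\emptyset$ for distinct $y,z\in Y$. *)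

theory Defs
  imports "HOL-Analysis.Analysis"
begin

unbundle cardinal_syntax

text \<open>
  Cardinals are rendered, as in the library, by cardinal orders up to order isomorphism.
  The library has neither the least cardinality of the members of a class of sets nor the
  supremum of a set of cardinals; the lemmas following the two definitions show that the
  choices are well-defined. In the second one it suffices to compare with upper bounds on
  the same type, since every smaller cardinal is represented there.
\<close>

definition least_cardinality :: "'b set set \<Rightarrow> 'b rel" where
  "least_cardinality F = (SOME \<kappa>. \<exists>A\<in>F. \<kappa> = |A| \<and> (\<forall>B\<in>F. |A| \<le>o |B| ))"

definition cardinal_sup :: "'b rel set \<Rightarrow> 'b rel" where
  "cardinal_sup R = (SOME \<kappa>. Card_order \<kappa> \<and> (\<forall>\<rho>\<in>R. \<rho> \<le>o \<kappa>) \<and>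
     (\<forall>\<mu> :: 'b rel. Card_order \<mu> \<and> (\<forall>\<rho>\<in>R. \<rho> \<le>o \<mu>) \<longrightarrow> \<kappa> \<le>o \<mu>))"

lemma least_cardinality:
  assumes "F \<noteq> {}"
  shows "\<exists>A\<in>F. least_cardinality F = |A| \<and> (\<forall>B\<in>F. |A| \<le>o |B| )"
proof -
  have "\<exists>r\<in>card_of ` F. \<forall>r'\<in>card_of ` F. r \<le>o r'"
    by (rule exists_minim_Card_order) (use assms in \<open>auto simp: card_of_Card_order\<close>)
  then have "\<exists>\<kappa>. \<exists>A\<in>F. \<kappa> = |A| \<and> (\<forall>B\<in>F. |A| \<le>o |B| )"
    by blast
  from someI_ex[OF this] show ?thesis
    unfolding least_cardinality_def .
qed

lemma cardinal_sup:
  fixes R :: "'b rel set"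
  assumes "\<forall>\<rho>\<in>R. Card_order \<rho>"
  shows "Card_order (cardinal_sup R) \<and> (\<forall>\<rho>\<in>R. \<rho> \<le>o cardinal_sup R) \<and>
    (\<forall>\<mu> :: 'b rel. Card_order \<mu> \<and> (\<forall>\<rho>\<in>R. \<rho> \<le>o \<mu>) \<longrightarrow> cardinal_sup R \<le>o \<mu>)"
proof -
  define M :: "'b rel set" where "M = {\<mu>. Card_order \<mu> \<and> (\<forall>\<rho>\<in>R. \<rho> \<le>o \<mu>)}"
  have "\<rho> \<le>o |UNIV :: 'b set|" if "\<rho> \<in> R" for \<rho>
    using that assms card_of_Field_ordIso card_of_mono1[OF subset_UNIV]
      ordIso_ordLeq_trans ordIso_symmetric by blast
  then have "|UNIV :: 'b set| \<in> M"
    by (simp add: M_def card_of_Card_order)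
  then have "\<exists>r\<in>M. \<forall>r'\<in>M. r \<le>o r'"
    by (intro exists_minim_Card_order) (auto simp: M_def)
  then have "\<exists>\<kappa> :: 'b rel. Card_order \<kappa> \<and> (\<forall>\<rho>\<in>R. \<rho> \<le>o \<kappa>) \<and>
      (\<forall>\<mu> :: 'b rel. Card_order \<mu> \<and> (\<forall>\<rho>\<in>R. \<rho> \<le>o \<mu>) \<longrightarrow> \<kappa> \<le>o \<mu>)"
    unfolding M_def by blast
  from someI_ex[OF this] show ?thesis
    unfolding cardinal_sup_def .
qed

definition closed_pseudobase_at :: "'a topology \<Rightarrow> 'a \<Rightarrow> 'a set set \<Rightarrow> bool" where
  "closed_pseudobase_at X p \<U> \<longleftrightarrow> \<U> \<noteq> {} \<and> (\<forall>U\<in>\<U>. openin X U) \<and>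
     {p} = (\<Inter>U\<in>\<U>. U) \<and> {p} = (\<Inter>U\<in>\<U>. X closure_of U)"

definition closed_pseudocharacter_at :: "'a topology \<Rightarrow> 'a \<Rightarrow> 'a set rel" where
  "closed_pseudocharacter_at X p = least_cardinality {\<U>. closed_pseudobase_at X p \<U>}"

definition closed_pseudocharacter :: "'a topology \<Rightarrow> 'a set rel" where
  "closed_pseudocharacter X = cardinal_sup (closed_pseudocharacter_at X ` topspace X)"

definition strongly_discrete_in :: "'a topology \<Rightarrow> 'a set \<Rightarrow> bool" where
  "strongly_discrete_in X Y \<longleftrightarrow> Y \<subseteq> topspace X \<and>
     (\<exists>u :: 'a \<Rightarrow> 'a set. (\<forall>y\<in>Y. openin X (u y) \<and> y \<in> u y) \<and>
        (\<forall>y\<in>Y. \<forall>z\<in>Y. y \<noteq> z \<longrightarrow> u y \<inter> u z = {}))"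

text \<open>
  The library's \<open>countably_compact\<close> is restricted to type-class topologies; the following is the
  analogue of \<open>compactin\<close> and \<open>compact_space\<close>.
\<close>

definition countably_compactin :: "'a topology \<Rightarrow> 'a set \<Rightarrow> bool" where
  "countably_compactin X S \<longleftrightarrow> S \<subseteq> topspace X \<and>
     (\<forall>\<U>. countable \<U> \<and> (\<forall>U\<in>\<U>. openin X U) \<and> S \<subseteq> \<Union>\<U>
        \<longrightarrow> (\<exists>\<F>. finite \<F> \<and> \<F> \<subseteq> \<U> \<and> S \<subseteq> \<Union>\<F>))"

definition countably_compact_space :: "'a topology \<Rightarrow> bool" where
  "countably_compact_space X \<longleftrightarrow> countably_compactin X (topspace X)"

end

theory Submission
  imports Defs "HOL-Library.Countable_Set_Type"
begin

text \<open>
  Countable closed pseudocharacter gives, at each point \<open>p\<close>, a decreasing sequence \<open>U\<close> of open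
  neighbourhoods whose closures meet only in \<open>p\<close>. The proof shows that \<open>U\<close> is a
  neighbourhood base at \<open>p\<close>, then that even the closures of its members are small, which is
  regularity.

  Compactness enters in one way. If \<open>K\<close> is countably compact and \<open>V\<close> is an open
  neighbourhood of \<open>p\<close>, then \<open>V\<close> and the complements of the closures of the \<open>U n\<close> form a countable
  open cover of \<open>K\<close>, so \<open>V\<close> contains \<open>K \<inter> X closure_of U n\<close> for some \<open>n\<close>. Suppose now that
  points \<open>z n \<in> X closure_of U n\<close> lie outside \<open>V\<close>. Each \<open>z n\<close> is outside the closure of some
  later \<open>U m\<close>, so along a subsequence the \<open>z n\<close> are in the closures of pairwise disjoint open
  shells, each shell being the difference of some \<open>U n\<close> and the closure of the next chosen \<open>U m\<close>.
  If each \<open>z n\<close> is in the closure of a countable strongly discrete subset of its shell, then the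
  union of these subsets is strongly discrete, its closure is countably compact and contains the
  \<open>z n\<close>, and this contradicts the first remark (lemma \<open>trapped_in_neighbourhood\<close>).

  For \<open>z n \<in> U n\<close> the subset can be the singleton of \<open>z n\<close>; this gives first countability. Once
  all the pseudobases are bases, any point in the closure of an open set is approached by a
  countable strongly discrete subset of that open set, namely a sequence running through the
  shells of the point; this gives regularity.

  Finally, an open cover \<open>G 0, G 1, \<dots>\<close> without finite subcover yields points \<open>s n\<close> outside
  \<open>G 0 \<union> \<dots> \<union> G n\<close>. The range of \<open>s\<close> is discrete, so it is strongly discrete by
  regularity, and its countably compact closure is covered by finitely many \<open>G n\<close>, which is
  absurd.
\<close>

section \<open>Shrinking sequences of open neighbourhoods\<close>

definition shrinks_to :: "'a topology \<Rightarrow> (nat \<Rightarrow> 'a set) \<Rightarrow> 'a \<Rightarrow> bool" where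
  "shrinks_to X U p \<longleftrightarrow> (\<forall>n. openin X (U n) \<and> p \<in> U n) \<and> decseq U \<and>
     (\<Inter>n. X closure_of U n) = {p}"

text \<open>
  Replacing an enumerated pseudobase by its finite intersections makes it decreasing, and the
  closures only become smaller.
\<close>

lemma countable_closed_pseudobase_imp_shrinks_to:
  assumes "closed_pseudobase_at X p \<U>" and "countable \<U>"
  shows "\<exists>U. shrinks_to X U p"
proof -
  have ne: "\<U> \<noteq> {}" and op: "\<And>U. U \<in> \<U> \<Longrightarrow> openin X U"
    and p: "\<And>U. U \<in> \<U> \<Longrightarrow> p \<in> U" and cl: "(\<Inter>U\<in>\<U>. X closure_of U) = {p}"
    using assms(1) unfolding closed_pseudobase_at_def by auto
  define e where "e = from_nat_into \<U>"
  have e: "range e = \<U>"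
    unfolding e_def using ne assms(2) by simp
  define U where "U n = (\<Inter>i\<le>n. e i)" for n
  have opU: "openin X (U n)" and pU: "p \<in> U n" for n
    unfolding U_def using op p e by (blast intro: openin_INT2)+
  have "decseq U"
    unfolding U_def by (rule decseq_SucI) (auto simp: atMost_Suc)
  moreover have "(\<Inter>n. X closure_of U n) = {p}"
  proof -
    have "X closure_of U n \<subseteq> X closure_of e n" for n
      unfolding U_def by (intro closure_of_mono) auto
    then have "(\<Inter>n. X closure_of U n) \<subseteq> (\<Inter>n. X closure_of e n)"
      by blast
    moreover have "(\<Inter>n. X closure_of e n) = {p}"
      using cl unfolding e[symmetric] by simp
    moreover have "p \<in> X closure_of U n" for n
      using pU opU closure_of_subset openin_subset by (metis subsetD)
    ultimately show ?thesis
      by (intro equalityI) auto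
  qed
  ultimately show ?thesis
    using opU pU unfolding shrinks_to_def by (intro exI[of _ U]) simp
qed

text \<open>
  In a Hausdorff space the family of all open neighbourhoods of a point is a closed pseudobase,
  so the least cardinality in the definition of the pseudocharacter is attained.
\<close>

lemma Hausdorff_space_closed_pseudobase_at:
  assumes "Hausdorff_space X" and p: "p \<in> topspace X"
  shows "closed_pseudobase_at X p {U. openin X U \<and> p \<in> U}"
proof -
  let ?N = "{U. openin X U \<and> p \<in> U}"
  have sep: "\<exists>U\<in>?N. q \<notin> X closure_of U" if q: "q \<in> topspace X" "q \<noteq> p" for q
  proof -
    obtain U V where "openin X U" "openin X V" "p \<in> U" "q \<in> V" "disjnt U V"
      using assms q unfolding Hausdorff_space_def by metis
    then show ?thesis
      unfolding in_closure_of disjnt_iff by blast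
  qed
  have sub: "U \<subseteq> X closure_of U" if "U \<in> ?N" for U
    using that by (intro closure_of_subset openin_subset) simp
  have top: "topspace X \<in> ?N"
    using p by simp
  have le: "q = p" if "\<And>U. U \<in> ?N \<Longrightarrow> q \<in> X closure_of U" for q
  proof (rule ccontr)
    assume "q \<noteq> p"
    moreover have "q \<in> topspace X"
      using that[OF top] by simp
    ultimately show False
      using sep that by blast
  qed
  have "(\<Inter>U\<in>?N. X closure_of U) \<subseteq> {p}"
    by (auto intro: le)
  moreover have "(\<Inter>U\<in>?N. U) \<subseteq> (\<Inter>U\<in>?N. X closure_of U)"
    by (rule INT_anti_mono[OF subset_refl sub])
  moreover have "{p} \<subseteq> (\<Inter>U\<in>?N. U)"
    by simp
  ultimately have "{p} = (\<Inter>U\<in>?N. X closure_of U)" "{p} = (\<Inter>U\<in>?N. U)"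
    by (metis (no_types, lifting) subset_antisym subset_trans)+
  then show ?thesis
    unfolding closed_pseudobase_at_def using top by auto
qed

lemma countable_closed_pseudocharacter_imp_shrinks_to:
  assumes "Hausdorff_space X" and le: "closed_pseudocharacter X \<le>o natLeq"
    and p: "p \<in> topspace X"
  shows "\<exists>U. shrinks_to X U p"
proof -
  have char: "\<exists>A. closed_pseudobase_at X q A \<and> closed_pseudocharacter_at X q = |A|"
    if "q \<in> topspace X" for q
  proof -
    have "{A. closed_pseudobase_at X q A} \<noteq> {}"
      using Hausdorff_space_closed_pseudobase_at[OF assms(1) that] by (metis empty_iff mem_Collect_eq)
    from least_cardinality[OF this] show ?thesis
      unfolding closed_pseudocharacter_at_def by auto
  qed
  have "\<forall>\<rho>\<in>closed_pseudocharacter_at X ` topspace X. Card_order \<rho>"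
    using char card_of_Card_order by (metis imageE)
  from cardinal_sup[OF this] have "closed_pseudocharacter_at X p \<le>o closed_pseudocharacter X"
    unfolding closed_pseudocharacter_def using p by simp
  then have "closed_pseudocharacter_at X p \<le>o natLeq"
    using le ordLeq_transitive by blast
  then obtain A where "closed_pseudobase_at X p A" "countable A"
    using char[OF p] countable_card_le_natLeq by metis
  then show ?thesis
    by (rule countable_closed_pseudobase_imp_shrinks_to)
qed

lemma shrinks_toD:
  assumes "shrinks_to X U p"
  shows "openin X (U n)" "p \<in> U n" "p \<in> topspace X"
    and "m \<le> n \<Longrightarrow> U n \<subseteq> U m" "m \<le> n \<Longrightarrow> X closure_of U n \<subseteq> X closure_of U m"
    and "U n \<subseteq> X closure_of U n"
proof -
  show "openin X (U n)" "p \<in> U n"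
    using assms unfolding shrinks_to_def by auto
  then show "U n \<subseteq> X closure_of U n" "p \<in> topspace X"
    using closure_of_subset openin_subset by (metis subsetD)+
  show "U n \<subseteq> U m" if "m \<le> n"
    using assms that unfolding shrinks_to_def by (auto dest: decseqD)
  then show "X closure_of U n \<subseteq> X closure_of U m" if "m \<le> n"
    using that by (simp add: closure_of_mono)
qed

text \<open>
  The sets \<open>U (r k) - X closure_of U (r (Suc k))\<close> are the shells in which the points of a sequence
  are separated from each other.
\<close>

lemma shrinks_to_obtain_shells:
  assumes U: "shrinks_to X U p" and z: "\<And>n. z n \<in> topspace X \<and> z n \<noteq> p"
  obtains r :: "nat \<Rightarrow> nat"
  where "strict_mono r" and "\<And>k. z (r k) \<notin> X closure_of U (r (Suc k))"
proof -
  have "\<exists>m>n. z n \<notin> X closure_of U m" for n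
  proof -
    obtain m where "z n \<notin> X closure_of U m"
      using U z[of n] unfolding shrinks_to_def by blast
    moreover have "X closure_of U (max m (Suc n)) \<subseteq> X closure_of U m"
      by (rule shrinks_toD(5)[OF U]) simp
    ultimately show ?thesis
      by (intro exI[of _ "max m (Suc n)"]) auto
  qed
  then obtain f where f: "\<And>n. f n > n \<and> z n \<notin> X closure_of U (f n)"
    by metis
  define r where "r k = (f ^^ k) 0" for k
  have "strict_mono r"
    unfolding r_def strict_mono_Suc_iff using f by simp
  moreover have "z (r k) \<notin> X closure_of U (r (Suc k))" for k
    unfolding r_def using f by simp
  ultimately show ?thesis
    using that by blast
qed

section \<open>Strongly discrete sets\<close>

lemma strongly_discrete_in_singleton:
  "x \<in> topspace X \<Longrightarrow> strongly_discrete_in X {x}"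
  unfolding strongly_discrete_in_def by auto

lemma strongly_discrete_in_Union:
  assumes E: "\<And>k :: nat. strongly_discrete_in X (E k)"
    and W: "\<And>k. openin X (W k)" "\<And>k. E k \<subseteq> W k"
    and disj: "\<And>j k. j < k \<Longrightarrow> W j \<inter> W k = {}"
  shows "strongly_discrete_in X (\<Union>k. E k)"
proof -
  have disj': "W j \<inter> W k = {}" if "j \<noteq> k" for j k
    using that disj[of j k] disj[of k j] by (cases j k rule: linorder_cases) auto
  have "\<exists>u. (\<forall>y\<in>E k. openin X (u y) \<and> y \<in> u y) \<and> (\<forall>y\<in>E k. \<forall>z\<in>E k. y \<noteq> z \<longrightarrow> u y \<inter> u z = {})" for k
    using E[of k] unfolding strongly_discrete_in_def by blast
  then obtain u where u: "\<And>k y. y \<in> E k \<Longrightarrow> openin X (u k y) \<and> y \<in> u k y"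
    and ud: "\<And>k y z. y \<in> E k \<Longrightarrow> z \<in> E k \<Longrightarrow> y \<noteq> z \<Longrightarrow> u k y \<inter> u k z = {}"
    by metis
  obtain i where i: "\<And>y. y \<in> (\<Union>k. E k) \<Longrightarrow> y \<in> E (i y)"
    by (metis UN_E)
  define v where "v y = u (i y) y \<inter> W (i y)" for y
  have "openin X (v y) \<and> y \<in> v y" if "y \<in> (\<Union>k. E k)" for y
    using i[OF that] u W unfolding v_def by blast
  moreover have "v y \<inter> v z = {}" if "y \<in> (\<Union>k. E k)" "z \<in> (\<Union>k. E k)" "y \<noteq> z" for y z
  proof (cases "i y = i z")
    case True
    then show ?thesis
      using ud[of y "i y" z] i[OF that(1)] i[OF that(2)] that(3) unfolding v_def by auto
  next
    case False
    then show ?thesis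
      using disj' unfolding v_def by blast
  qed
  moreover have "(\<Union>k. E k) \<subseteq> topspace X"
    using E unfolding strongly_discrete_in_def by blast
  ultimately show ?thesis
    unfolding strongly_discrete_in_def by blast
qed

lemma strongly_discrete_in_Union_shells:
  assumes U: "shrinks_to X U p" and r: "strict_mono r"
    and E: "\<And>k. strongly_discrete_in X (E k)"
    and sub: "\<And>k. E k \<subseteq> U (r k) - X closure_of U (r (Suc k))"
  shows "strongly_discrete_in X (\<Union>k. E k)"
proof (rule strongly_discrete_in_Union[OF E _ sub])
  show "openin X (U (r k) - X closure_of U (r (Suc k)))" for k
    by (intro openin_diff shrinks_toD(1)[OF U] closedin_closure_of)
  show "(U (r j) - X closure_of U (r (Suc j))) \<inter> (U (r k) - X closure_of U (r (Suc k))) = {}"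
    if "j < k" for j k
  proof -
    have "r (Suc j) \<le> r k"
      using r that by (simp add: strict_mono_less_eq)
    then have "U (r k) \<subseteq> X closure_of U (r (Suc j))"
      using shrinks_toD(4)[OF U] shrinks_toD(6)[OF U] by blast
    then show ?thesis by blast
  qed
qed

text \<open>
  From closed neighbourhoods that meet the set in one point, disjoint neighbourhoods arise by
  removing from each the finitely many that precede it in an enumeration of the set.
\<close>

lemma regular_space_countable_discrete_imp_strongly_discrete:
  assumes "regular_space X" and "countable D" and "D \<subseteq> topspace X"
    and disc: "\<And>d. d \<in> D \<Longrightarrow> \<exists>N. openin X N \<and> N \<inter> D = {d}"
  shows "strongly_discrete_in X D"
proof -
  have "\<exists>V. openin X V \<and> d \<in> V \<and> X closure_of V \<inter> D = {d}" if "d \<in> D" for d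
  proof -
    obtain N where N: "openin X N" "N \<inter> D = {d}"
      using disc[OF \<open>d \<in> D\<close>] by blast
    have "closedin X (topspace X - N)" "d \<in> topspace X - (topspace X - N)"
      using N openin_subset by auto
    then obtain V V' where V: "openin X V" "openin X V'" "d \<in> V" "topspace X - N \<subseteq> V'" "disjnt V V'"
      using assms(1) unfolding regular_space_def by metis
    have "X closure_of V \<subseteq> N"
      using V unfolding disjnt_iff in_closure_of subset_iff by blast
    moreover have "d \<in> X closure_of V"
      using V closure_of_subset openin_subset by (metis subsetD)
    ultimately show ?thesis
      using V N by blast
  qed
  then obtain V where V: "\<And>d. d \<in> D \<Longrightarrow> openin X (V d) \<and> d \<in> V d \<and> X closure_of V d \<inter> D = {d}"
    by metis
  define idx where "idx = to_nat_on D"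
  have inj: "inj_on idx D"
    unfolding idx_def using \<open>countable D\<close> by (rule inj_on_to_nat_on)
  define P where "P d = {e \<in> D. idx e < idx d}" for d
  define W where "W d = V d - (\<Union>e\<in>P d. X closure_of V e)" for d
  have fin: "finite (P d)" for d
    by (rule inj_on_finite[of idx _ "{..<idx d}"]) (auto simp: P_def intro: inj_on_subset[OF inj])
  have "openin X (W d) \<and> d \<in> W d" if "d \<in> D" for d
  proof -
    have "closedin X (\<Union>e\<in>P d. X closure_of V e)"
      using fin by (intro closedin_Union) auto
    moreover have "d \<notin> X closure_of V e" if "e \<in> P d" for e
      using that V[of e] \<open>d \<in> D\<close> unfolding P_def by auto
    ultimately show ?thesis
      using V[OF \<open>d \<in> D\<close>] unfolding W_def by (auto intro: openin_diff)
  qed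
  moreover have less: "W d \<inter> W e = {}" if "d \<in> D" "e \<in> D" "idx d < idx e" for d e
  proof -
    have "V d \<subseteq> X closure_of V d"
      using V[OF \<open>d \<in> D\<close>] closure_of_subset openin_subset by metis
    then show ?thesis
      using that unfolding W_def P_def by blast
  qed
  moreover have "W d \<inter> W e = {}" if "d \<in> D" "e \<in> D" "d \<noteq> e" for d e
  proof -
    have "idx d \<noteq> idx e"
      using inj that by (auto dest: inj_onD)
    then show ?thesis
      using less[of d e] less[of e d] that by (auto simp: neq_iff)
  qed
  ultimately show ?thesis
    unfolding strongly_discrete_in_def using \<open>D \<subseteq> topspace X\<close> by blast
qed

section \<open>Pseudobases become bases\<close>

text \<open>
  The complements of the closures of the \<open>U n\<close> cover everything except \<open>p\<close>, and they increase, so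
  in a finite subcover one of them absorbs the others.
\<close>

lemma countably_compactin_closures_in_neighbourhood:
  assumes K: "countably_compactin X K" and U: "shrinks_to X U p"
    and V: "openin X V" "p \<in> V"
  shows "\<exists>n. K \<inter> X closure_of U n \<subseteq> V"
proof -
  define C where "C n = topspace X - X closure_of U n" for n
  have "K \<subseteq> \<Union>(insert V (range C))"
  proof
    fix x assume "x \<in> K"
    then have "x \<in> topspace X"
      using K unfolding countably_compactin_def by blast
    then show "x \<in> \<Union>(insert V (range C))"
      using U V unfolding shrinks_to_def C_def by (cases "x = p") auto
  qed
  moreover have "openin X A" if "A \<in> insert V (range C)" for A
    using that V unfolding C_def by auto
  moreover have "countable (insert V (range C))"
    by simp
  ultimately obtain F where F: "finite F" "F \<subseteq> insert V (range C)" "K \<subseteq> \<Union>F"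
    using K unfolding countably_compactin_def by meson
  have "finite (F - {V})" "F - {V} \<subseteq> range C"
    using F by auto
  then obtain I where I: "finite I" "F - {V} = C ` I"
    using finite_subset_image[of "F - {V}" C UNIV] by blast
  have "K \<inter> X closure_of U (Max (insert 0 I)) \<subseteq> V"
  proof
    fix x assume x: "x \<in> K \<inter> X closure_of U (Max (insert 0 I))"
    have "x \<notin> C i" if "i \<in> I" for i
    proof -
      have "i \<le> Max (insert 0 I)"
        using I that by simp
      then have "x \<in> X closure_of U i"
        using shrinks_toD(5)[OF U] x by blast
      then show ?thesis
        unfolding C_def by simp
    qed
    then show "x \<in> V"
      using x F(3) I(2) by blast
  qed
  then show ?thesis ..
qed

text \<open>
  The step common to first countability, where \<open>A n = U n\<close>, and regularity, where
  \<open>A n = X closure_of U n\<close>. Points of the \<open>A n\<close> outside \<open>V\<close> would all lie, along a subsequence, in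
  the closure of one countable strongly discrete set, glued from approximating sets in disjoint
  shells, and the countable compactness of that closure forces some of them into \<open>V\<close>.
\<close>

lemma trapped_in_neighbourhood:
  assumes cc: "\<And>D. countable D \<Longrightarrow> strongly_discrete_in X D \<Longrightarrow> countably_compactin X (X closure_of D)"
    and U: "shrinks_to X U p" and V: "openin X V" "p \<in> V"
    and A: "\<And>n. A n \<subseteq> X closure_of U n"
    and approx: "\<And>n m z. z \<in> A n \<Longrightarrow> z \<notin> X closure_of U m \<Longrightarrow>
      \<exists>D. countable D \<and> strongly_discrete_in X D \<and> D \<subseteq> U n - X closure_of U m \<and> z \<in> X closure_of D"
  shows "\<exists>n. A n \<subseteq> V"
proof (rule ccontr)
  assume "\<nexists>n. A n \<subseteq> V"
  then have "\<forall>n. \<exists>x. x \<in> A n \<and> x \<notin> V"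
    by blast
  then obtain z where z: "\<And>n. z n \<in> A n" "\<And>n. z n \<notin> V"
    by metis
  have "z n \<in> topspace X \<and> z n \<noteq> p" for n
    using z[of n] A[of n] V closure_of_subset_topspace by fastforce
  then obtain r where r: "strict_mono r"
    and out: "\<And>k. z (r k) \<notin> X closure_of U (r (Suc k))"
    using shrinks_to_obtain_shells[OF U] by blast
  obtain D where D: "\<And>k. countable (D k)" "\<And>k. strongly_discrete_in X (D k)"
      "\<And>k. D k \<subseteq> U (r k) - X closure_of U (r (Suc k))" "\<And>k. z (r k) \<in> X closure_of D k"
    using approx[OF z(1) out] by metis
  have "countably_compactin X (X closure_of (\<Union>k. D k))"
    using D strongly_discrete_in_Union_shells[OF U r] by (intro cc) auto
  from countably_compactin_closures_in_neighbourhood[OF this U V]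
  obtain n where n: "X closure_of (\<Union>k. D k) \<inter> X closure_of U n \<subseteq> V"
    by blast
  have "z (r n) \<in> X closure_of (\<Union>k. D k)"
    using D(4)[of n] closure_of_mono[of "D n" "\<Union>k. D k"] by blast
  moreover have "z (r n) \<in> X closure_of U n"
    using z(1) A shrinks_toD(5)[OF U strict_mono_imp_increasing[OF r]] subsetD by metis
  ultimately show False
    using n z(2) by blast
qed

lemma shrinks_to_imp_neighbourhood_base:
  assumes "\<And>D. countable D \<Longrightarrow> strongly_discrete_in X D \<Longrightarrow> countably_compactin X (X closure_of D)"
    and U: "shrinks_to X U p" and V: "openin X V" "p \<in> V"
  shows "\<exists>n. U n \<subseteq> V"
proof (rule trapped_in_neighbourhood[OF assms(1) U V])
  fix n m z assume z: "z \<in> U n" "z \<notin> X closure_of U m"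
  then have top: "z \<in> topspace X"
    using shrinks_toD(1)[OF U] openin_subset by blast
  then have "z \<in> X closure_of {z}"
    using closure_of_subset[of "{z}" X] by blast
  then show "\<exists>D. countable D \<and> strongly_discrete_in X D \<and> D \<subseteq> U n - X closure_of U m \<and> z \<in> X closure_of D"
    using z strongly_discrete_in_singleton[OF top] by (intro exI[of _ "{z}"]) auto
qed (use shrinks_toD(6)[OF U] in auto)

text \<open>
  A sequence in \<open>W\<close> that converges to \<open>z\<close> can be thinned out so that its terms lie in different
  shells of \<open>z\<close>.
\<close>

lemma closure_of_open_by_strongly_discrete:
  assumes U: "shrinks_to X U z"
    and base: "\<And>V. openin X V \<Longrightarrow> z \<in> V \<Longrightarrow> \<exists>n. U n \<subseteq> V"
    and W: "openin X W" and z: "z \<in> X closure_of W"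
  shows "\<exists>D. countable D \<and> strongly_discrete_in X D \<and> D \<subseteq> W \<and> z \<in> X closure_of D"
proof (cases "z \<in> W")
  case True
  have top: "z \<in> topspace X"
    by (rule shrinks_toD(3)[OF U])
  then have "z \<in> X closure_of {z}"
    using closure_of_subset[of "{z}" X] by blast
  then show ?thesis
    using True strongly_discrete_in_singleton[OF top] by (intro exI[of _ "{z}"]) auto
next
  case False
  have "\<exists>y. y \<in> W \<and> y \<in> U n" for n
    using z shrinks_toD(1,2)[OF U] unfolding in_closure_of by blast
  then obtain y where y: "\<And>n. y n \<in> W" "\<And>n. y n \<in> U n"
    by metis
  have ytop: "y n \<in> topspace X" for n
    using y(1) openin_subset[OF W] by blast
  moreover have "y n \<noteq> z" for n
    using y(1) False by metis
  ultimately obtain r where r: "strict_mono r"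
    and out: "\<And>k. y (r k) \<notin> X closure_of U (r (Suc k))"
    using shrinks_to_obtain_shells[OF U] by blast
  define D where "D = (\<Union>k. {y (r k)})"
  have "strongly_discrete_in X D"
    unfolding D_def using strongly_discrete_in_singleton[OF ytop] y(2) out
    by (intro strongly_discrete_in_Union_shells[OF U r]) auto
  moreover have "countable D" "D \<subseteq> W"
    unfolding D_def using y(1) by auto
  moreover have "z \<in> X closure_of D"
    unfolding in_closure_of
  proof (intro conjI allI impI)
    show "z \<in> topspace X"
      by (rule shrinks_toD(3)[OF U])
    fix T assume "z \<in> T \<and> openin X T"
    then obtain n where "U n \<subseteq> T"
      using base by blast
    moreover have "y (r n) \<in> U n"
      using y(2) shrinks_toD(4)[OF U strict_mono_imp_increasing[OF r]] subsetD by metis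
    ultimately show "\<exists>x. x \<in> D \<and> x \<in> T"
      unfolding D_def by blast
  qed
  ultimately show ?thesis by blast
qed

lemma shrinks_to_imp_closed_neighbourhood_base:
  assumes cc: "\<And>D. countable D \<Longrightarrow> strongly_discrete_in X D \<Longrightarrow> countably_compactin X (X closure_of D)"
    and shrink: "\<And>q. q \<in> topspace X \<Longrightarrow> \<exists>U. shrinks_to X U q"
    and U: "shrinks_to X U p" and V: "openin X V" "p \<in> V"
  shows "\<exists>n. X closure_of U n \<subseteq> V"
proof (rule trapped_in_neighbourhood[OF cc U V])
  fix n m z assume z: "z \<in> X closure_of U n" "z \<notin> X closure_of U m"
  then have top: "z \<in> topspace X"
    unfolding in_closure_of by blast
  obtain U' where U': "shrinks_to X U' z"
    using shrink[OF top] by blast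
  let ?W = "U n - X closure_of U m"
  have "z \<in> X closure_of ?W"
    unfolding in_closure_of
  proof (intro conjI allI impI top)
    fix T assume T: "z \<in> T \<and> openin X T"
    (* near z the closure of U m can be cut away, as z is not in it *)
    then have "openin X (T - X closure_of U m)" "z \<in> T - X closure_of U m"
      using z(2) by (auto intro: openin_diff)
    then show "\<exists>x. x \<in> ?W \<and> x \<in> T"
      using z(1) unfolding in_closure_of[of z] by blast
  qed
  moreover have "openin X ?W"
    using shrinks_toD(1)[OF U] by (intro openin_diff) auto
  ultimately show "\<exists>D. countable D \<and> strongly_discrete_in X D \<and> D \<subseteq> ?W \<and> z \<in> X closure_of D"
    using closure_of_open_by_strongly_discrete[OF U' shrinks_to_imp_neighbourhood_base[OF cc U']]
    by blast
qed auto

section \<open>Countable compactness\<close>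

text \<open>
  A sequence that leaves the members of a cover one after another meets each of them in only
  finitely many points, hence has discrete range; regularity makes the range strongly discrete.
\<close>

lemma regular_t1_countably_compact_space:
  assumes reg: "regular_space X" and t1: "t1_space X"
    and cc: "\<And>D. countable D \<Longrightarrow> strongly_discrete_in X D \<Longrightarrow> countably_compactin X (X closure_of D)"
  shows "countably_compact_space X"
  unfolding countably_compact_space_def countably_compactin_def
proof (intro conjI allI impI subset_refl)
  fix \<G> assume "countable \<G> \<and> (\<forall>U\<in>\<G>. openin X U) \<and> topspace X \<subseteq> \<Union>\<G>"
  then have G: "countable \<G>" "\<And>U. U \<in> \<G> \<Longrightarrow> openin X U" "topspace X \<subseteq> \<Union>\<G>"
    by auto
  show "\<exists>\<F>. finite \<F> \<and> \<F> \<subseteq> \<G> \<and> topspace X \<subseteq> \<Union>\<F>"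
  proof (rule ccontr)
    assume no: "\<nexists>\<F>. finite \<F> \<and> \<F> \<subseteq> \<G> \<and> topspace X \<subseteq> \<Union>\<F>"
    then have "\<G> \<noteq> {}"
      using G(3) by auto
    define g where "g = from_nat_into \<G>"
    have g: "range g = \<G>"
      unfolding g_def using \<open>\<G> \<noteq> {}\<close> G(1) by simp
    have "\<exists>x. x \<in> topspace X \<and> (\<forall>i\<le>n. x \<notin> g i)" for n
    proof -
      have "finite (g ` {..n})" "g ` {..n} \<subseteq> \<G>"
        using g by auto
      then have "\<not> topspace X \<subseteq> \<Union>(g ` {..n})"
        using no by blast
      then show ?thesis by auto
    qed
    then obtain s where s: "\<And>n. s n \<in> topspace X" "\<And>n i. i \<le> n \<Longrightarrow> s n \<notin> g i"
      by metis
    let ?D = "range s"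
    have top: "?D \<subseteq> topspace X"
      using s(1) by blast
    have "\<exists>N. openin X N \<and> N \<inter> ?D = {d}" if "d \<in> ?D" for d
    proof -
      obtain k where k: "d \<in> g k"
        using \<open>d \<in> ?D\<close> top G(3) g by blast
      (* only the finitely many points with index below k can lie in g k *)
      let ?N = "g k - (s ` {..<k} - {d})"
      have "closedin X (s ` {..<k} - {d})"
        by (rule t1[unfolded t1_space_closedin_finite, rule_format]) (use s(1) in auto)
      moreover have "openin X (g k)"
        using G(2) g by blast
      ultimately have "openin X ?N"
        by (intro openin_diff)
      moreover have "?N \<inter> ?D = {d}"
      proof
        show "?N \<inter> ?D \<subseteq> {d}"
        proof
          fix x assume x: "x \<in> ?N \<inter> ?D"
          then obtain n where n: "x = s n" by blast
          have "n < k"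
            using x s(2)[of k n] n by (metis DiffD1 IntD1 not_le)
          then show "x \<in> {d}"
            using x n by blast
        qed
        show "{d} \<subseteq> ?N \<inter> ?D"
          using k that by blast
      qed
      ultimately show ?thesis by blast
    qed
    then have "strongly_discrete_in X ?D"
      using regular_space_countable_discrete_imp_strongly_discrete[OF reg _ top] by simp
    then have "countably_compactin X (X closure_of ?D)"
      by (intro cc) simp_all
    moreover have "X closure_of ?D \<subseteq> \<Union>\<G>"
      using closure_of_subset_topspace[of X ?D] G(3) by blast
    ultimately obtain \<F> where F: "finite \<F>" "\<F> \<subseteq> \<G>" "X closure_of ?D \<subseteq> \<Union>\<F>"
      using G(1,2) unfolding countably_compactin_def by meson
    obtain I where I: "finite I" "\<F> = g ` I"
      using finite_subset_image[of \<F> g UNIV] F g by blast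
    have "s (Max (insert 0 I)) \<in> \<Union>\<F>"
      using F(3) closure_of_subset[OF top] by blast
    then obtain i where i: "i \<in> I" "s (Max (insert 0 I)) \<in> g i"
      using I(2) by blast
    have "i \<le> Max (insert 0 I)"
      using I(1) i(1) by simp
    then show False
      using s(2) i(2) by blast
  qed
qed

theorem theorem2p7:
  fixes X :: "'a topology"
  assumes "Hausdorff_space X"
    and "closed_pseudocharacter X \<le>o natLeq"
    and "\<And>D. countable D \<Longrightarrow> strongly_discrete_in X D \<Longrightarrow> countably_compactin X (X closure_of D)"
  shows "countably_compact_space X \<and> (regular_space X \<and> t1_space X) \<and> first_countable X"
proof -
  note shrink = countable_closed_pseudocharacter_imp_shrinks_to[OF assms(1,2)]
  have reg: "regular_space X"
    unfolding regular_space_def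
  proof (intro allI impI, elim conjE)
    fix C a assume C: "closedin X C" and a: "a \<in> topspace X - C"
    obtain U where U: "shrinks_to X U a"
      using shrink a by blast
    have "openin X (topspace X - C)"
      using C by blast
    then obtain n where n: "X closure_of U n \<subseteq> topspace X - C"
      using shrinks_to_imp_closed_neighbourhood_base[OF assms(3) shrink U _ a] by blast
    have "openin X (topspace X - X closure_of U n)"
      by (intro openin_diff) auto
    moreover have "C \<subseteq> topspace X - X closure_of U n"
      using n closedin_subset[OF C] by blast
    moreover have "disjnt (U n) (topspace X - X closure_of U n)"
      using shrinks_toD(6)[OF U] unfolding disjnt_iff by blast
    ultimately show "\<exists>U V. openin X U \<and> openin X V \<and> a \<in> U \<and> C \<subseteq> V \<and> disjnt U V"
      using shrinks_toD(1,2)[OF U] by blast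
  qed
  have t1: "t1_space X"
    by (rule Hausdorff_imp_t1_space[OF assms(1)])
  have "first_countable X"
    unfolding first_countable_def
  proof
    fix x assume "x \<in> topspace X"
    then obtain U where U: "shrinks_to X U x"
      using shrink by blast
    have "\<exists>B\<in>range U. x \<in> B \<and> B \<subseteq> V" if "openin X V \<and> x \<in> V" for V
      using shrinks_to_imp_neighbourhood_base[OF assms(3) U, of V] that shrinks_toD(2)[OF U] by blast
    moreover have "countable (range U)" "\<forall>B\<in>range U. openin X B"
      using shrinks_toD(1)[OF U] by auto
    ultimately show "\<exists>\<B>. countable \<B> \<and> (\<forall>V\<in>\<B>. openin X V) \<and>
        (\<forall>V. openin X V \<and> x \<in> V \<longrightarrow> (\<exists>B\<in>\<B>. x \<in> B \<and> B \<subseteq> V))"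
      by blast
  qed
  then show ?thesis
    using regular_t1_countably_compact_space[OF reg t1 assms(3)] reg t1 by blast
qed

end
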